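(* Let $d$ be a positive integer, let $G$ be a $d$-regular graph on $n$ vertices, let $C$ be the number of non-bipartite induced subgraphs of $G$, and let $\lambda \ge 1$ be a real number. Then $$P(\lambda, G)^2 \le P(\lambda, K_{d,d})^{\frac{n}{d}} - 2C .$$
   Context: All graphs are finite and simple (undirected, no loops, no multiple edges). An independent set of a graph $G$ is a set of vertices no two of which are adjacent (the empty set is independent); $\mathcal{I}(G)$ denotes the family of all independent sets of $G$. The independence polynomial is $P(\lambda, G) = \sum_{I \in \mathcal{I}(G)} \lambda^{|I|}$. $K_{d,d}$ is the complete bipartite graph with both parts of size $d$. For $A \subseteq V(G)$, $G[A]$ is the subgraph of $G$ induced by $A$; the number $C$ of non-bipartite induced subgraphs is the number of vertex subsets $A \subseteq V(G)$ such that $G[A]$ is not bipartite. *)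

theory Defs
  imports Complex_Main "Graph_Theory.Kuratowski"
begin

text \<open>
  A finite simple undirected graph is a \<open>graph\<close> in the sense of the imported library: a finite
  symmetric digraph without loops and parallel arcs, in which every undirected edge is represented
  by its two opposite arcs. Hence \<open>u\<close> and \<open>v\<close> are adjacent iff \<open>u \<rightarrow>\<^bsub>G\<^esub> v\<close>, and the degree of a
  vertex is its out-degree (equivalently, its in-degree).
\<close>

definition regular_graph :: "nat \<Rightarrow> ('a, 'b) pre_digraph \<Rightarrow> bool" where
  "regular_graph d G \<longleftrightarrow> graph G \<and> (\<forall>v \<in> verts G. out_degree G v = d)"

definition independent_sets :: "('a, 'b) pre_digraph \<Rightarrow> 'a set set" where
  "independent_sets G = {I. I \<subseteq> verts G \<and> (\<forall>u \<in> I. \<forall>v \<in> I. \<not> u \<rightarrow>\<^bsub>G\<^esub> v)}"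

definition independence_polynomial :: "real \<Rightarrow> ('a, 'b) pre_digraph \<Rightarrow> real" where
  "independence_polynomial x G = (\<Sum>I \<in> independent_sets G. x ^ card I)"

definition bipartite_graph :: "('a, 'b) pre_digraph \<Rightarrow> bool" where
  "bipartite_graph G \<longleftrightarrow> graph G \<and>
     (\<exists>U V. verts G = U \<union> V \<and> U \<inter> V = {} \<and> arcs_ends G \<subseteq> U \<times> V \<union> V \<times> U)"

text \<open>Induced subgraphs are counted by their vertex sets, not up to isomorphism.\<close>

definition num_nonbipartite_induced :: "('a, 'b) pre_digraph \<Rightarrow> nat" where
  "num_nonbipartite_induced G = card {A. A \<subseteq> verts G \<and> \<not> bipartite_graph (G \<restriction> A)}"

text \<open>
  The library's \<open>K\<^bsub>m,n\<^esub>\<close> is a predicate on graphs; it is satisfiable for all sizes of the two parts.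
\<close>

lemma complete_bipartite_digraph_exists:
  "\<exists>K :: (nat + nat, (nat + nat) \<times> (nat + nat)) pre_digraph. K\<^bsub>m,n\<^esub> K"
proof -
  let ?U = "Inl ` {..<m} :: (nat + nat) set" and ?V = "Inr ` {..<n} :: (nat + nat) set"
  have "K\<^bsub>m,n\<^esub> (with_proj \<lparr>pverts = ?U \<union> ?V, parcs = ?U \<times> ?V \<union> ?V \<times> ?U\<rparr>)"
    unfolding complete_bipartite_digraph_pair_def
    by (intro conjI exI[of _ ?U] exI[of _ ?V]) (auto simp: card_image)
  then show ?thesis by blast
qed

end

theory Submission
  imports Defs
begin

text \<open>
  Zhao's bipartite swapping trick embeds the pairs of independent sets of \<open>G\<close>, with the same total
  size, into the independent sets of the bipartite double cover \<open>G \<times> K\<^sub>2\<close>, missing at least two of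
  weight at least 1 for every non-bipartite induced subgraph. Summing over the independent sets of
  \<open>G \<times> K\<^sub>2\<close> by their trace \<open>A\<close> on one side gives \<open>\<Sum>A. \<lambda>^|A| \<Prod>b. f b (A \<inter> N b)\<close>, where \<open>f b T\<close> is
  \<open>1 + \<lambda>\<close> if \<open>T\<close> is empty and 1 otherwise. Every vertex lies in exactly \<open>d\<close> of the \<open>n\<close> neighbourhoods
  \<open>N b\<close>, so Finner's generalized Hoelder inequality bounds the sum by the product of the \<open>d\<close>-norms of
  the \<open>f b\<close>, and the \<open>d\<close>-th power of each norm is exactly \<open>P(\<lambda>, K\<^bsub>d,d\<^esub>)\<close>.
\<close>

section \<open>Generalized Hoelder inequality on a Boolean cube\<close>

text \<open>AM-GM without roots. Polya's argument divides by the mean \<open>m\<close>, so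
  \<open>m = 0\<close>, where every \<open>r i\<close> vanishes, is a separate case.\<close>

lemma prod_le_mean_power:
  fixes r :: "'i \<Rightarrow> real"
  assumes "finite I" "I \<noteq> {}" "\<And>i. i \<in> I \<Longrightarrow> 0 \<le> r i"
  shows "(\<Prod>i\<in>I. r i) \<le> ((\<Sum>i\<in>I. r i) / card I) ^ card I"
proof -
  define m where "m = (\<Sum>i\<in>I. r i) / card I"
  have card: "card I > 0" using assms by (simp add: card_gt_0_iff)
  have m0: "m \<ge> 0" unfolding m_def by (intro divide_nonneg_nonneg sum_nonneg) (use assms in auto)
  show ?thesis
  proof (cases "m = 0")
    case True
    then have "(\<Sum>i\<in>I. r i) = 0" using card by (simp add: m_def)
    then have "\<forall>i\<in>I. r i = 0" using assms by (simp add: sum_nonneg_eq_0_iff)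
    then have "(\<Prod>i\<in>I. r i) = 0" using assms(1,2) by auto
    then show ?thesis using m0 unfolding m_def by simp
  next
    case False
    then have m: "m > 0" using m0 by simp
    \<comment> \<open>\<open>t \<le> exp (t - 1)\<close> for \<open>t = r i / m\<close>; the exponents add up to 0.\<close>
    have "(\<Prod>i\<in>I. r i / m) \<le> (\<Prod>i\<in>I. exp (r i / m - 1))"
    proof (rule prod_mono)
      fix i assume "i \<in> I"
      then show "0 \<le> r i / m \<and> r i / m \<le> exp (r i / m - 1)"
        using assms m exp_ge_add_one_self[of "r i / m - 1"] by simp
    qed
    also have "\<dots> = exp ((\<Sum>i\<in>I. r i) / m - card I)"
      using assms(1) by (simp add: exp_sum[symmetric] sum_subtractf sum_divide_distrib)
    also have "(\<Sum>i\<in>I. r i) / m = card I"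
      using m card by (simp add: m_def field_simps)
    finally have "(\<Prod>i\<in>I. r i) / m ^ card I \<le> 1"
      by (simp add: prod_dividef)
    then show ?thesis using m by (simp add: m_def[symmetric] field_simps)
  qed
qed

lemma prod_root_le_mean:
  fixes t :: "'i \<Rightarrow> real"
  assumes "finite I" "I \<noteq> {}" "\<And>i. i \<in> I \<Longrightarrow> 0 \<le> t i"
  shows "(\<Prod>i\<in>I. root (card I) (t i)) \<le> (\<Sum>i\<in>I. t i) / card I"
proof -
  have card: "card I > 0" using assms by (simp add: card_gt_0_iff)
  have "(\<Prod>i\<in>I. root (card I) (t i)) ^ card I = (\<Prod>i\<in>I. t i)"
    using assms card by (simp add: prod_power_distrib)
  also have "\<dots> \<le> ((\<Sum>i\<in>I. t i) / card I) ^ card I"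
    by (rule prod_le_mean_power[OF assms])
  \<comment> \<open>The comparison of bases is stated for exponents \<open>Suc k\<close>, hence the
    instance \<open>card I - 1\<close>.\<close>
  finally show ?thesis
    by (rule power_le_imp_le_base[of _ "card I - 1", simplified Suc_diff_1[OF card]])
       (intro divide_nonneg_nonneg sum_nonneg, use assms in auto)
qed

text \<open>Two-point Hoelder inequality for \<open>d\<close> functions. Divide by the right-hand
  side and apply AM-GM to the ratios \<open>u i / s i\<close> and to \<open>v i / s i\<close>, where
  \<open>s i = u i + v i\<close>: the two means add up to 1.\<close>

lemma prod_root_add_le:
  fixes u v :: "'i \<Rightarrow> real"
  assumes "finite I" "card I = d" "d > 0"
    and u: "\<And>i. i \<in> I \<Longrightarrow> 0 \<le> u i" and v: "\<And>i. i \<in> I \<Longrightarrow> 0 \<le> v i"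
  shows "(\<Prod>i\<in>I. root d (u i)) + (\<Prod>i\<in>I. root d (v i)) \<le> (\<Prod>i\<in>I. root d (u i + v i))"
proof (cases "\<exists>i\<in>I. u i + v i = 0")
  case True
  \<comment> \<open>Division by \<open>s i\<close> is impossible here, but the factor at
    \<open>i\<close> makes all three products vanish.\<close>
  then obtain i where i: "i \<in> I" "u i + v i = 0" by blast
  with u v have "u i = 0" "v i = 0" by (auto simp: add_nonneg_eq_0_iff)
  then have "(\<Prod>i\<in>I. root d (u i)) = 0" "(\<Prod>i\<in>I. root d (v i)) = 0"
    "(\<Prod>i\<in>I. root d (u i + v i)) = 0"
    using i assms(1) by (auto intro!: bexI[of _ i])
  then show ?thesis by simp
next
  case False
  define s where "s i = u i + v i" for i
  have s: "s i > 0" if "i \<in> I" for i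
    using False u[OF that] v[OF that] that unfolding s_def
    by (metis add_nonneg_nonneg less_eq_real_def)
  have ne: "I \<noteq> {}" using assms by auto
  have "(\<Prod>i\<in>I. root d (u i / s i)) + (\<Prod>i\<in>I. root d (v i / s i))
      \<le> (\<Sum>i\<in>I. u i / s i) / d + (\<Sum>i\<in>I. v i / s i) / d"
    using prod_root_le_mean[OF assms(1) ne, of "\<lambda>i. u i / s i"]
      prod_root_le_mean[OF assms(1) ne, of "\<lambda>i. v i / s i"] assms(2) u v s
    by (intro add_mono) (auto simp: less_imp_le)
  also have "\<dots> = (\<Sum>i\<in>I. u i / s i + v i / s i) / d"
    by (simp add: sum.distrib add_divide_distrib)
  also have "(\<Sum>i\<in>I. u i / s i + v i / s i) = (\<Sum>i\<in>I. 1)"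
  proof (rule sum.cong)
    fix i assume "i \<in> I"
    then show "u i / s i + v i / s i = 1"
      using s[of i] by (simp add: add_divide_distrib[symmetric]) (simp add: s_def)
  qed simp
  also have "\<dots> / d = 1" using assms by simp
  finally have "((\<Prod>i\<in>I. root d (u i)) + (\<Prod>i\<in>I. root d (v i))) / (\<Prod>i\<in>I. root d (s i)) \<le> 1"
    by (simp add: real_root_divide prod_dividef add_divide_distrib)
  moreover have "(\<Prod>i\<in>I. root d (s i)) > 0"
    using s assms(3) by (intro prod_pos) auto
  ultimately show ?thesis by (simp add: s_def[symmetric] field_simps)
qed

text \<open>Serves in both directions below: to sum out one coordinate of the cube, and to put it
  back into \<open>Pow (N b)\<close>.\<close>

lemma sum_Pow_insert:
  fixes g :: "'a set \<Rightarrow> real"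
  assumes "finite V" "v \<notin> V"
  shows "(\<Sum>S\<in>Pow (insert v V). x ^ card S * g S)
    = (\<Sum>S\<in>Pow V. x ^ card S * (g S + x * g (insert v S)))"
proof -
  have "(\<Sum>S\<in>Pow (insert v V). x ^ card S * g S)
    = (\<Sum>S\<in>Pow V. x ^ card S * g S) + (\<Sum>S\<in>insert v ` Pow V. x ^ card S * g S)"
    unfolding Pow_insert by (rule sum.union_disjoint) (use assms in auto)
  also have "(\<Sum>S\<in>insert v ` Pow V. x ^ card S * g S)
    = (\<Sum>S\<in>Pow V. x ^ card (insert v S) * g (insert v S))"
    by (subst sum.reindex) (use assms in \<open>auto intro!: inj_onI simp: o_def\<close>)
  also have "\<dots> = (\<Sum>S\<in>Pow V. x ^ card S * (x * g (insert v S)))"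
    using assms finite_subset[of _ V]
    by (intro sum.cong refl) (auto simp: card_insert_if subset_iff)
  finally show ?thesis by (simp add: sum.distrib distrib_left)
qed

lemma sum_Pow_power_card:
  fixes x :: real
  assumes "finite M"
  shows "(\<Sum>S\<in>Pow M. x ^ card S) = (1 + x) ^ card M"
  using assms
proof (induction M)
  case empty
  then show ?case by simp
next
  case (insert v M)
  then show ?case
    using sum_Pow_insert[OF insert.hyps, of x "\<lambda>_. 1"]
    by (simp flip: sum_distrib_right)
qed

text \<open>
  One coordinate is summed out at a time: the \<open>d\<close> factors that depend on it are combined by the
  two-point Hoelder inequality, and the resulting functions satisfy the hypotheses again.
\<close>

lemma sum_prod_root_le:
  fixes F :: "'i \<Rightarrow> 'a set \<Rightarrow> real" and x :: real
  assumes "finite V" "finite B" "d > 0" "x \<ge> 0"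
    and "\<And>b. b \<in> B \<Longrightarrow> N b \<subseteq> V"
    and "\<And>v. v \<in> V \<Longrightarrow> card {b \<in> B. v \<in> N b} = d"
    and "\<And>b T. b \<in> B \<Longrightarrow> 0 \<le> F b T"
  shows "(\<Sum>S\<in>Pow V. x ^ card S * (\<Prod>b\<in>B. root d (F b (S \<inter> N b))))
    \<le> (\<Prod>b\<in>B. root d (\<Sum>T\<in>Pow (N b). x ^ card T * F b T))"
  using assms(1,5-)
proof (induction V arbitrary: N F)
  case empty
  then have "N b = {}" if "b \<in> B" for b using that by blast
  then show ?case by simp
next
  case (insert v V)
  define B1 where "B1 = {b \<in> B. v \<in> N b}"
  define B0 where "B0 = {b \<in> B. v \<notin> N b}"
  have B: "B = B1 \<union> B0" "B1 \<inter> B0 = {}" "finite B1" "finite B0"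
    using assms(2) by (auto simp: B1_def B0_def)
  have split: "prod h B = prod h B1 * prod h B0" for h :: "'i \<Rightarrow> real"
    unfolding B(1) by (rule prod.union_disjoint) (use B in auto)
  have cB1: "card B1 = d" using insert.prems(2)[of v] by (simp add: B1_def)
  define N' where "N' b = N b - {v}" for b
  \<comment> \<open>\<open>F' b\<close> is \<open>F b\<close> with the coordinate \<open>v\<close>
    summed out with weights 1 and \<open>x\<close>; a factor that does not see \<open>v\<close>
    stays as it is.\<close>
  define F' where "F' b T = (if v \<in> N b then F b T + x * F b (insert v T) else F b T)" for b T
  have F': "0 \<le> F' b T" if "b \<in> B" for b T
    using insert.prems(3)[OF that] assms(4) by (simp add: F'_def)
  have step: "(\<Prod>b\<in>B. root d (F b (S \<inter> N b))) + x * (\<Prod>b\<in>B. root d (F b (insert v S \<inter> N b)))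
      \<le> (\<Prod>b\<in>B. root d (F' b (S \<inter> N' b)))" if "S \<in> Pow V" for S
  proof -
    have vS: "v \<notin> S" using that insert.hyps by auto
    let ?p = "\<Prod>b\<in>B0. root d (F b (S \<inter> N b))"
    have p0: "?p \<ge> 0"
      by (intro prod_nonneg) (auto simp: B0_def intro!: real_root_ge_zero insert.prems(3))
    have ins: "(\<Prod>b\<in>B0. root d (F b (insert v S \<inter> N b))) = ?p"
      by (intro prod.cong) (auto simp: B0_def)
    \<comment> \<open>Exactly \<open>d\<close> factors see \<open>v\<close>, so the outer weight
      \<open>x\<close> splits into \<open>d\<close> equal factors \<open>root d x\<close>, one under
      each root.\<close>
    have x: "x * (\<Prod>b\<in>B1. root d (F b (insert v S \<inter> N b)))
        = (\<Prod>b\<in>B1. root d (x * F b (insert v S \<inter> N b)))"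
      using assms(3,4) cB1 by (simp add: real_root_mult prod.distrib)
    have "(\<Prod>b\<in>B. root d (F b (S \<inter> N b))) + x * (\<Prod>b\<in>B. root d (F b (insert v S \<inter> N b)))
      = ((\<Prod>b\<in>B1. root d (F b (S \<inter> N b)))
          + (\<Prod>b\<in>B1. root d (x * F b (insert v S \<inter> N b)))) * ?p"
      unfolding split ins x[symmetric] by (simp add: algebra_simps)
    also have "\<dots> \<le> (\<Prod>b\<in>B1. root d (F b (S \<inter> N b) + x * F b (insert v S \<inter> N b))) * ?p"
      using assms(3,4) B(3) cB1 p0
      by (intro mult_right_mono prod_root_add_le) (auto simp: B1_def intro!: insert.prems(3) mult_nonneg_nonneg)
    also have "(\<Prod>b\<in>B1. root d (F b (S \<inter> N b) + x * F b (insert v S \<inter> N b)))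
        = (\<Prod>b\<in>B1. root d (F' b (S \<inter> N' b)))"
    proof (intro prod.cong refl)
      fix b assume "b \<in> B1"
      then have "v \<in> N b" "S \<inter> N b = S \<inter> N' b" "insert v S \<inter> N b = insert v (S \<inter> N' b)"
        using vS by (auto simp: B1_def N'_def)
      then show "root d (F b (S \<inter> N b) + x * F b (insert v S \<inter> N b)) = root d (F' b (S \<inter> N' b))"
        by (simp add: F'_def)
    qed
    also have "?p = (\<Prod>b\<in>B0. root d (F' b (S \<inter> N' b)))"
    proof (intro prod.cong refl)
      fix b assume "b \<in> B0"
      then have "v \<notin> N b" "S \<inter> N b = S \<inter> N' b"
        by (auto simp: B0_def N'_def)
      then show "root d (F b (S \<inter> N b)) = root d (F' b (S \<inter> N' b))"
        by (simp add: F'_def)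
    qed
    finally show ?thesis unfolding split[of "\<lambda>b. root d (F' b (S \<inter> N' b))"] .
  qed
  have "(\<Sum>S\<in>Pow (insert v V). x ^ card S * (\<Prod>b\<in>B. root d (F b (S \<inter> N b))))
    = (\<Sum>S\<in>Pow V. x ^ card S * ((\<Prod>b\<in>B. root d (F b (S \<inter> N b)))
        + x * (\<Prod>b\<in>B. root d (F b (insert v S \<inter> N b)))))"
    by (rule sum_Pow_insert[OF insert.hyps])
  also have "\<dots> \<le> (\<Sum>S\<in>Pow V. x ^ card S * (\<Prod>b\<in>B. root d (F' b (S \<inter> N' b))))"
    using step assms(4) by (intro sum_mono mult_left_mono) auto
  also have "\<dots> \<le> (\<Prod>b\<in>B. root d (\<Sum>T\<in>Pow (N' b). x ^ card T * F' b T))"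
  proof (rule insert.IH)
    show "N' b \<subseteq> V" if "b \<in> B" for b
      using insert.prems(1)[OF that] by (auto simp: N'_def)
    show "card {b \<in> B. w \<in> N' b} = d" if "w \<in> V" for w
    proof -
      have "{b \<in> B. w \<in> N' b} = {b \<in> B. w \<in> N b}"
        using that insert.hyps by (auto simp: N'_def)
      then show ?thesis using insert.prems(2)[of w] that by simp
    qed
  qed (rule F')
  \<comment> \<open>For \<open>v \<in> N b\<close>, the definition of \<open>F'\<close> is just what
    restores the sum over all subsets of \<open>N b\<close>.\<close>
  also have "\<dots> = (\<Prod>b\<in>B. root d (\<Sum>T\<in>Pow (N b). x ^ card T * F b T))"
  proof (intro prod.cong refl arg_cong[where f = "root d"])
    fix b assume b: "b \<in> B"
    show "(\<Sum>T\<in>Pow (N' b). x ^ card T * F' b T) = (\<Sum>T\<in>Pow (N b). x ^ card T * F b T)"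
    proof (cases "v \<in> N b")
      case True
      then have N: "N b = insert v (N' b)" by (auto simp: N'_def)
      have "finite (N' b)" "v \<notin> N' b"
        using insert.prems(1)[OF b] insert.hyps(1) finite_subset by (auto simp: N'_def)
      from sum_Pow_insert[OF this, of x "F b"] True show ?thesis
        unfolding N[symmetric] by (simp add: F'_def)
    next
      case False
      then show ?thesis by (simp add: N'_def F'_def)
    qed
  qed
  finally show ?case .
qed

section \<open>Independent sets of regular graphs\<close>

text \<open>
  These pairs are the independent sets of the bipartite double cover \<open>G \<times> K\<^sub>2\<close>.
\<close>

definition cross_independent :: "('a, 'b) pre_digraph \<Rightarrow> ('a set \<times> 'a set) set" where
  "cross_independent G =
    {(A, B). A \<subseteq> verts G \<and> B \<subseteq> verts G \<and> (\<forall>u\<in>A. \<forall>v\<in>B. \<not> u \<rightarrow>\<^bsub>G\<^esub> v)}"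

section \<open>Two-colourings of induced subgraphs and the swapping trick\<close>

lemma graph_induce_subgraph:
  assumes "graph G" "A \<subseteq> verts G"
  shows "graph (G \<restriction> A)"
proof -
  interpret graph G by fact
  have fin: "finite A" using assms(2) finite_verts finite_subset by blast
  show ?thesis
  proof
    show "symmetric (G \<restriction> A)"
      using sym_arcs unfolding symmetric_conv
      by (metis (no_types, lifting) induce_subgraph_arcs induce_subgraph_head
          induce_subgraph_tail mem_Collect_eq)
  qed (use fin no_loops no_multi_arcs in auto)
qed

lemma dominates_induce_subgraph_iff:
  "u \<rightarrow>\<^bsub>G \<restriction> A\<^esub> v \<longleftrightarrow> u \<in> A \<and> v \<in> A \<and> u \<rightarrow>\<^bsub>G\<^esub> v"
  by (auto simp: arcs_ends_conv)

text \<open>Encodes a two-colouring by the single class \<open>Y\<close>, the set on which the swap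
  takes place.\<close>

lemma bipartite_induced_iff:
  assumes "graph G" "A \<subseteq> verts G"
  shows "bipartite_graph (G \<restriction> A) \<longleftrightarrow>
    (\<exists>Y\<subseteq>A. \<forall>u\<in>A. \<forall>v\<in>A. u \<rightarrow>\<^bsub>G\<^esub> v \<longrightarrow> (u \<in> Y \<longleftrightarrow> v \<notin> Y))"
proof
  assume "bipartite_graph (G \<restriction> A)"
  then obtain U V where UV: "A = U \<union> V" "U \<inter> V = {}" "arcs_ends (G \<restriction> A) \<subseteq> U \<times> V \<union> V \<times> U"
    by (auto simp: bipartite_graph_def)
  have "u \<in> V \<longleftrightarrow> v \<notin> V" if "u \<in> A" "v \<in> A" "u \<rightarrow>\<^bsub>G\<^esub> v" for u v
  proof -
    have "u \<rightarrow>\<^bsub>G \<restriction> A\<^esub> v" using that by (simp add: dominates_induce_subgraph_iff)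
    then show ?thesis using UV by blast
  qed
  then show "\<exists>Y\<subseteq>A. \<forall>u\<in>A. \<forall>v\<in>A. u \<rightarrow>\<^bsub>G\<^esub> v \<longrightarrow> (u \<in> Y \<longleftrightarrow> v \<notin> Y)"
    using UV(1) by (intro exI[of _ V]) auto
next
  assume "\<exists>Y\<subseteq>A. \<forall>u\<in>A. \<forall>v\<in>A. u \<rightarrow>\<^bsub>G\<^esub> v \<longrightarrow> (u \<in> Y \<longleftrightarrow> v \<notin> Y)"
  then obtain Y where "Y \<subseteq> A" "\<And>u v. u \<in> A \<Longrightarrow> v \<in> A \<Longrightarrow> u \<rightarrow>\<^bsub>G\<^esub> v \<Longrightarrow> (u \<in> Y \<longleftrightarrow> v \<notin> Y)"
    by metis
  then show "bipartite_graph (G \<restriction> A)"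
    unfolding bipartite_graph_def using graph_induce_subgraph[OF assms]
    by (intro conjI exI[of _ "A - Y"] exI[of _ Y]) (auto simp: dominates_induce_subgraph_iff)
qed

text \<open>
  If \<open>Y\<close> is one colour class of \<open>G[A \<union> B]\<close>, exchanging \<open>A\<close> and \<open>B\<close>
  on \<open>Y\<close> is an involution that turns an independent pair into a cross-independent one. The pairs
  \<open>(A, \<emptyset>)\<close> and \<open>(\<emptyset>, A)\<close> with \<open>G[A]\<close> non-bipartite are not reached.
\<close>

lemma independence_polynomial_square_le:
  fixes G :: "('a, 'b) pre_digraph" and x :: real
  assumes G: "graph G" and x: "x \<ge> 1"
  shows "(independence_polynomial x G)\<^sup>2 + 2 * real (num_nonbipartite_induced G)
    \<le> (\<Sum>(A, B)\<in>cross_independent G. x ^ (card A + card B))"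
proof -
  interpret graph G by fact
  \<comment> \<open>The colour class depends on \<open>W\<close> alone. Swapping keeps
    \<open>A \<union> B\<close>, so a second swap uses the same class and undoes the first, even
    where \<open>c W\<close> is an arbitrary value.\<close>
  define c where "c W = (SOME Y. Y \<subseteq> W \<and> (\<forall>u\<in>W. \<forall>v\<in>W. u \<rightarrow>\<^bsub>G\<^esub> v \<longrightarrow> (u \<in> Y \<longleftrightarrow> v \<notin> Y)))" for W
  have c: "c W \<subseteq> W" "\<And>u v. u \<in> W \<Longrightarrow> v \<in> W \<Longrightarrow> u \<rightarrow>\<^bsub>G\<^esub> v \<Longrightarrow> (u \<in> c W \<longleftrightarrow> v \<notin> c W)"
    if "W \<subseteq> verts G" "bipartite_graph (G \<restriction> W)" for W
  proof -
    have "\<exists>Y. Y \<subseteq> W \<and> (\<forall>u\<in>W. \<forall>v\<in>W. u \<rightarrow>\<^bsub>G\<^esub> v \<longrightarrow> (u \<in> Y \<longleftrightarrow> v \<notin> Y))"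
      using that bipartite_induced_iff[OF G] by blast
    from someI_ex[OF this]
    show "c W \<subseteq> W" "\<And>u v. u \<in> W \<Longrightarrow> v \<in> W \<Longrightarrow> u \<rightarrow>\<^bsub>G\<^esub> v \<Longrightarrow> (u \<in> c W \<longleftrightarrow> v \<notin> c W)"
      unfolding c_def[symmetric] by blast+
  qed
  define w where "w = (\<lambda>(A :: 'a set, B :: 'a set). x ^ (card A + card B))"
  define \<phi> where "\<phi> = (\<lambda>(A, B). let Y = c (A \<union> B) in (A - Y \<union> B \<inter> Y, B - Y \<union> A \<inter> Y))"
  define I2 where "I2 = independent_sets G \<times> independent_sets G"
  define Nb where "Nb = {A. A \<subseteq> verts G \<and> \<not> bipartite_graph (G \<restriction> A)}"
  define L where "L = (\<lambda>A. (A, {} :: 'a set)) ` Nb"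
  define R where "R = (\<lambda>A. ({} :: 'a set, A)) ` Nb"
  have finv: "finite A" if "A \<subseteq> verts G" for A using that finite_verts finite_subset by blast
  have finI: "finite (independent_sets G)"
    by (rule finite_subset[of _ "Pow (verts G)"]) (auto simp: independent_sets_def)
  have finC: "finite (cross_independent G)"
    by (rule finite_subset[of _ "Pow (verts G) \<times> Pow (verts G)"]) (auto simp: cross_independent_def)
  have finN: "finite Nb" by (rule finite_subset[of _ "Pow (verts G)"]) (auto simp: Nb_def)

  have union: "(case \<phi> p of (A, B) \<Rightarrow> A \<union> B) = (case p of (A, B) \<Rightarrow> A \<union> B)" for p
    by (cases p) (auto simp: \<phi>_def Let_def)
  have invol: "\<phi> (\<phi> p) = p" for p
  proof (cases p)
    case (Pair A B)
    let ?Y = "c (A \<union> B)"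
    have "\<phi> p = (A - ?Y \<union> B \<inter> ?Y, B - ?Y \<union> A \<inter> ?Y)" by (simp add: Pair \<phi>_def Let_def)
    moreover have "(A - ?Y \<union> B \<inter> ?Y) \<union> (B - ?Y \<union> A \<inter> ?Y) = A \<union> B" by auto
    ultimately have "\<phi> (\<phi> p) = ((A - ?Y \<union> B \<inter> ?Y) - ?Y \<union> (B - ?Y \<union> A \<inter> ?Y) \<inter> ?Y,
        (B - ?Y \<union> A \<inter> ?Y) - ?Y \<union> (A - ?Y \<union> B \<inter> ?Y) \<inter> ?Y)"
      by (simp add: \<phi>_def Let_def)
    also have "\<dots> = (A, B)" by auto
    finally show ?thesis by (simp add: Pair)
  qed
  have inj: "inj_on \<phi> I2" by (rule inj_on_inverseI[of _ \<phi>]) (rule invol)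
  have wt: "w (\<phi> p) = w p" if "p \<in> I2" for p
  proof (cases p)
    case (Pair A B)
    let ?Y = "c (A \<union> B)"
    have fin: "finite A" "finite B" using that Pair finv by (auto simp: I2_def independent_sets_def)
    have "card (A - ?Y \<union> B \<inter> ?Y) = card (A - ?Y) + card (B \<inter> ?Y)"
      "card (B - ?Y \<union> A \<inter> ?Y) = card (B - ?Y) + card (A \<inter> ?Y)"
      using fin by (auto intro!: card_Un_disjoint)
    moreover have "card A = card (A \<inter> ?Y) + card (A - ?Y)" "card B = card (B \<inter> ?Y) + card (B - ?Y)"
      using fin by (auto intro: card_Int_Diff)
    ultimately have "card (A - ?Y \<union> B \<inter> ?Y) + card (B - ?Y \<union> A \<inter> ?Y) = card A + card B"
      by linarith
    then show ?thesis by (simp add: Pair w_def \<phi>_def Let_def)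
  qed
  \<comment> \<open>\<open>A\<close> itself is a colour class: an edge inside
    \<open>A \<union> B\<close> has neither both ends in \<open>A\<close> nor both outside
    \<open>A\<close>, hence in \<open>B\<close>.\<close>
  have bip: "bipartite_graph (G \<restriction> (A \<union> B))"
    if "A \<in> independent_sets G" "B \<in> independent_sets G" for A B
  proof -
    have "A \<union> B \<subseteq> verts G" using that by (auto simp: independent_sets_def)
    then show ?thesis using that bipartite_induced_iff[OF G, of "A \<union> B"]
      by (auto simp: independent_sets_def intro!: exI[of _ A])
  qed
  have sub: "\<phi> ` I2 \<subseteq> cross_independent G"
  proof
    fix q assume "q \<in> \<phi> ` I2"
    then obtain A B where AB: "A \<in> independent_sets G" "B \<in> independent_sets G" and q: "q = \<phi> (A, B)"
      by (auto simp: I2_def)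
    have W: "A \<union> B \<subseteq> verts G" using AB by (auto simp: independent_sets_def)
    note cW = c[OF W bip[OF AB]]
    \<comment> \<open>An edge between the two new sets would have exactly one end in
      \<open>Y\<close>. The swap moves only that end, so both ends come from the same one of
      \<open>A\<close> and \<open>B\<close>, which is independent.\<close>
    show "q \<in> cross_independent G"
      using AB cW(2) W by (auto simp: q \<phi>_def Let_def cross_independent_def independent_sets_def)
  qed
  have LR: "L \<subseteq> cross_independent G" "R \<subseteq> cross_independent G"
    by (auto simp: L_def R_def Nb_def cross_independent_def)
  \<comment> \<open>The only pair that \<open>L\<close> and \<open>R\<close> could share is the
    empty one, and the empty set is not in \<open>Nb\<close>.\<close>
  have "bipartite_graph (G \<restriction> {})"
    using bipartite_induced_iff[OF G, of "{}"] by simp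
  then have "L \<inter> R = {}" by (auto simp: L_def R_def Nb_def)
  \<comment> \<open>Pairs in the image of \<open>\<phi>\<close> have a union inducing a bipartite
    subgraph; for pairs in \<open>L\<close> and \<open>R\<close> the union lies in
    \<open>Nb\<close>.\<close>
  moreover have "\<phi> ` I2 \<inter> (L \<union> R) = {}"
  proof -
    have "(case q of (A, B) \<Rightarrow> bipartite_graph (G \<restriction> (A \<union> B)))" if "q \<in> \<phi> ` I2" for q
    proof -
      obtain A B where AB: "A \<in> independent_sets G" "B \<in> independent_sets G" and q: "q = \<phi> (A, B)"
        using \<open>q \<in> \<phi> ` I2\<close> by (auto simp: I2_def)
      show ?thesis using bip[OF AB] union[of "(A, B)"] q by (auto split: prod.splits)
    qed
    then show ?thesis by (fastforce simp: L_def R_def Nb_def)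
  qed
  moreover have fin: "finite (\<phi> ` I2)" "finite L" "finite R"
    using finI finN by (auto simp: I2_def L_def R_def)
  ultimately have "sum w (\<phi> ` I2) + (sum w L + sum w R) = sum w (\<phi> ` I2 \<union> (L \<union> R))"
    by (simp add: sum.union_disjoint)
  also have "\<dots> \<le> sum w (cross_independent G)"
    using sub LR finC x by (intro sum_mono2) (auto simp: w_def)
  finally have le: "sum w (\<phi> ` I2) + (sum w L + sum w R) \<le> sum w (cross_independent G)" .
  have "sum w (\<phi> ` I2) = sum w I2"
    using wt by (subst sum.reindex[OF inj]) simp
  also have "\<dots> = (independence_polynomial x G)\<^sup>2"
    by (simp add: I2_def w_def independence_polynomial_def power2_eq_square power_add
        sum_product sum.cartesian_product)
  finally have 1: "sum w (\<phi> ` I2) = (independence_polynomial x G)\<^sup>2" .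
  \<comment> \<open>By \<open>x \<ge> 1\<close>, each pair in \<open>L\<close> or \<open>R\<close>
    has weight at least 1.\<close>
  have "real (card Nb) \<le> sum w L" "real (card Nb) \<le> sum w R"
    unfolding L_def R_def
    using sum_mono[of Nb "\<lambda>_. 1" "\<lambda>A. x ^ card A"] x
    by (subst sum.reindex; auto simp: inj_on_def w_def)+
  with le 1 show ?thesis
    by (simp add: num_nonbipartite_induced_def Nb_def[symmetric] w_def)
qed

section \<open>Neighbourhoods, complete bipartite graphs and the Hoelder bound\<close>

lemma (in graph) card_out_neighbours:
  "card {v. u \<rightarrow>\<^bsub>G\<^esub> v} = out_degree G u"
proof -
  have "{v. u \<rightarrow>\<^bsub>G\<^esub> v} = head G ` out_arcs G u"
    by (auto simp: arcs_ends_conv out_arcs_def)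
  \<comment> \<open>Without parallel arcs, counting outgoing arcs is counting neighbours.\<close>
  moreover have "inj_on (head G) (out_arcs G u)"
    using no_multi_arcs by (auto simp: inj_on_def out_arcs_def arc_to_ends_def)
  ultimately show ?thesis by (simp add: out_degree_def card_image)
qed

text \<open>Vertices of different parts are adjacent, so an independent set lies within one part;
  the empty set lies in both and would be counted twice.\<close>

lemma independence_polynomial_complete_bipartite:
  assumes "K\<^bsub>m,n\<^esub> K"
  shows "independence_polynomial x K = (1 + x) ^ m + (1 + x) ^ n - 1"
proof -
  interpret graph K using assms by (simp add: complete_bipartite_digraph_def)
  obtain U V where UV: "verts K = U \<union> V" "U \<inter> V = {}" "card U = m" "card V = n"
      "arcs_ends K = U \<times> V \<union> V \<times> U"
    using assms by (auto simp: complete_bipartite_digraph_def)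
  have fin: "finite U" "finite V" using UV(1) finite_verts by (metis finite_Un)+
  have "independent_sets K = Pow U \<union> (Pow V - {{}})"
    using UV(2) unfolding independent_sets_def UV(1,5) by fast
  moreover have "(\<Sum>I\<in>Pow U \<union> (Pow V - {{}}). x ^ card I)
    = (\<Sum>I\<in>Pow U. x ^ card I) + (\<Sum>I\<in>Pow V - {{}}. x ^ card I)"
    using fin UV(2) by (intro sum.union_disjoint) auto
  moreover have "(\<Sum>I\<in>Pow V - {{}}. x ^ card I) = (\<Sum>I\<in>Pow V. x ^ card I) - 1"
    using fin by (subst sum_diff1) auto
  ultimately show ?thesis
    using fin UV(3,4) by (simp add: independence_polynomial_def sum_Pow_power_card)
qed

lemma sum_cross_independent_le:
  fixes G :: "('a, 'b) pre_digraph" and x :: real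
  assumes "d \<ge> 1" "regular_graph d G" "x \<ge> 0"
  shows "(\<Sum>(A, B)\<in>cross_independent G. x ^ (card A + card B))
    \<le> root d (2 * (1 + x) ^ d - 1) ^ card (verts G)"
proof -
  interpret graph G using assms by (simp add: regular_graph_def)
  have sym: "v \<rightarrow>\<^bsub>G\<^esub> u" if "u \<rightarrow>\<^bsub>G\<^esub> v" for u v
    using arcs_ends_symmetric[OF sym_arcs that] .
  define V where "V = verts G"
  define N where "N b = {v. v \<rightarrow>\<^bsub>G\<^esub> b}" for b
  \<comment> \<open>The \<open>d\<close>-th power of the factor \<open>1 + x\<close> or 1, so that
    \<open>root d\<close> gives that factor back.\<close>
  define F :: "'a \<Rightarrow> 'a set \<Rightarrow> real" where "F b T = (if T = {} then (1 + x) ^ d else 1)" for b T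
  have finV: "finite V" by (simp add: V_def)
  have NV: "N b \<subseteq> V" for b by (auto simp: N_def V_def dest: adj_in_verts)
  have cN: "card (N b) = d" if "b \<in> V" for b
  proof -
    have "N b = {v. b \<rightarrow>\<^bsub>G\<^esub> v}" by (auto simp: N_def intro: sym)
    then show ?thesis
      using assms(2) that by (simp add: V_def card_out_neighbours regular_graph_def)
  qed
  have finN: "finite (N b)" for b using NV finV finite_subset by blast
  have "(\<Sum>(A, B)\<in>cross_independent G. x ^ (card A + card B))
    = (\<Sum>A\<in>Pow V. \<Sum>B\<in>Pow {b \<in> V. A \<inter> N b = {}}. x ^ (card A + card B))"
  proof -
    \<comment> \<open>For fixed \<open>A\<close>, the admissible \<open>B\<close> are all the sets
      of vertices without a neighbour in \<open>A\<close>.\<close>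
    have "cross_independent G = (SIGMA A:Pow V. Pow {b \<in> V. A \<inter> N b = {}})"
      by (auto simp: cross_independent_def V_def N_def)
    then show ?thesis using finV by (simp add: sum.Sigma)
  qed
  also have "\<dots> = (\<Sum>A\<in>Pow V. x ^ card A * (\<Prod>b\<in>V. root d (F b (A \<inter> N b))))"
  proof (intro sum.cong refl)
    fix A assume "A \<in> Pow V"
    let ?M = "{b \<in> V. A \<inter> N b = {}}"
    have "(\<Sum>B\<in>Pow ?M. x ^ (card A + card B)) = x ^ card A * (1 + x) ^ card ?M"
      using finV by (simp add: power_add sum_distrib_left[symmetric] sum_Pow_power_card)
    also have "(1 + x) ^ card ?M = (\<Prod>b\<in>V. if A \<inter> N b = {} then 1 + x else 1)"
      using finV by (subst prod.inter_filter[symmetric]) simp_all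
    also have "\<dots> = (\<Prod>b\<in>V. root d (F b (A \<inter> N b)))"
      using assms(1,3) by (intro prod.cong) (auto simp: F_def real_root_power_cancel)
    finally show "(\<Sum>B\<in>Pow ?M. x ^ (card A + card B))
      = x ^ card A * (\<Prod>b\<in>V. root d (F b (A \<inter> N b)))" .
  qed
  also have "\<dots> \<le> (\<Prod>b\<in>V. root d (\<Sum>T\<in>Pow (N b). x ^ card T * F b T))"
  proof (rule sum_prod_root_le)
    fix v assume "v \<in> V"
    \<comment> \<open>Adjacency is symmetric, so the neighbourhoods containing \<open>v\<close> are
      those of its \<open>d\<close> neighbours.\<close>
    have "{b \<in> V. v \<in> N b} = N v"
      using adj_in_verts by (auto simp: N_def V_def intro: sym)
    then show "card {b \<in> V. v \<in> N b} = d" using cN \<open>v \<in> V\<close> by simp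
  qed (use finV assms NV in \<open>auto simp: F_def\<close>)
  also have "\<dots> = (\<Prod>b\<in>V. root d (2 * (1 + x) ^ d - 1))"
  proof (intro prod.cong refl arg_cong[where f = "root d"])
    fix b assume b: "b \<in> V"
    \<comment> \<open>Only the empty \<open>T\<close> carries the extra factor
      \<open>(1 + x) ^ d\<close>; the others contribute \<open>(1 + x) ^ d - 1\<close>.\<close>
    have "(\<Sum>T\<in>Pow (N b). x ^ card T * F b T)
      = (1 + x) ^ d + (\<Sum>T\<in>Pow (N b) - {{}}. x ^ card T * F b T)"
      using finN by (subst sum.remove[of _ "{}"]) (auto simp: F_def)
    also have "(\<Sum>T\<in>Pow (N b) - {{}}. x ^ card T * F b T) = (\<Sum>T\<in>Pow (N b) - {{}}. x ^ card T)"
      by (intro sum.cong) (auto simp: F_def)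
    also have "\<dots> = (1 + x) ^ d - 1"
      using finN b by (subst sum_diff1) (auto simp: sum_Pow_power_card cN)
    finally show "(\<Sum>T\<in>Pow (N b). x ^ card T * F b T) = 2 * (1 + x) ^ d - 1" by simp
  qed
  finally show ?thesis by (simp add: V_def)
qed

theorem mainTheorem1:
  fixes d n :: nat
    and G :: "('a, 'b) pre_digraph"
    and K :: "('c, 'e) pre_digraph"
    and x :: real
  assumes "d \<ge> 1"
    and "regular_graph d G"
    and "card (verts G) = n"
    and "K\<^bsub>d,d\<^esub> K"
    and "x \<ge> 1"
  shows "(independence_polynomial x G)\<^sup>2
    \<le> independence_polynomial x K powr (real n / real d) - 2 * real (num_nonbipartite_induced G)"
proof -
  let ?P = "2 * (1 + x) ^ d - 1"
  \<comment> \<open>Positivity of \<open>?P\<close> is what lets \<open>root d ?P ^ n\<close> be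
    rewritten with \<open>powr\<close>.\<close>
  have "1 \<le> (1 + x) ^ d" using assms(5) by (intro one_le_power) simp
  then have P: "?P > 0" by linarith
  have "(independence_polynomial x G)\<^sup>2 + 2 * real (num_nonbipartite_induced G)
      \<le> (\<Sum>(A, B)\<in>cross_independent G. x ^ (card A + card B))"
    using assms(2,5) by (intro independence_polynomial_square_le) (auto simp: regular_graph_def)
  also have "\<dots> \<le> root d ?P ^ n"
    using sum_cross_independent_le[OF assms(1,2), of x] assms(3,5) by simp
  also have "\<dots> = ?P powr (real n / real d)"
    using P assms(1) by (simp add: root_powr_inverse powr_powr flip: powr_realpow)
  also have "?P = independence_polynomial x K"
    using independence_polynomial_complete_bipartite[OF assms(4), of x] by simp
  finally show ?thesis by simp
qed

end
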